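(* For every integer $n\ge2$, $\log^*({}^n2)-\log^{\circledast}({}^n2)\ge\mathrm{slog}(\tfrac{2}{3}n)$.
   Context: All logarithms are base 2, and $\log(x)$ means $\log_2(\max(1,x))$; $\log^{[k]}$ is $k$-fold iteration of $\log$ ($\log^{[0]}$ the identity). For real $\alpha\ge0$, $\log^*(\alpha)$ is the smallest natural number $k$ with $\log^{[k]}(\alpha)\le1$. For real $\alpha>0$, $\log^{\circledast}(\alpha)$ is the largest natural number $k$ with $\log^{[k]}(\alpha)\ge k$; $\log^{\circledast}(0)=0$. Tetration of 2: ${}^02=1$ and ${}^n2=2^{({}^{n-1}2)}$ for $n\ge1$. Fix any extension of $n\mapsto{}^n2$ to a function from the nonnegative reals to $\mathbb{R}^{\ge1}=\{x\in\mathbb{R}:x\ge1\}$ that is increasing and surjective (such extensions exist). $\mathrm{slog}:\mathbb{R}^{\ge1}\to[0,\infty)$ is the inverse of this extended tetration; in particular $\mathrm{slog}({}^n2)=n$ for $n\in\mathbb{N}$. *)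

theory Defs
  imports Complex_Main
begin

definition lg :: "real \<Rightarrow> real"
  where "lg x = log 2 (max 1 x)"

definition log_star :: "real \<Rightarrow> nat"
  where "log_star \<alpha> = (LEAST k. (lg ^^ k) \<alpha> \<le> 1)"

definition log_circledast :: "real \<Rightarrow> nat"
  where "log_circledast \<alpha> = (if \<alpha> = 0 then 0 else GREATEST k. (lg ^^ k) \<alpha> \<ge> real k)"

primrec tetration :: "nat \<Rightarrow> real"
  where
    "tetration 0 = 1"
  | "tetration (Suc n) = 2 powr tetration n"

text \<open>
  A real extension of tetration lives on \<open>{0..}\<close>; its values at negative arguments are
  irrelevant. ``Increasing'' is meant strictly, since the extension has to be invertible.
\<close>

definition tetration_extension :: "(real \<Rightarrow> real) \<Rightarrow> bool"
  where "tetration_extension T \<longleftrightarrow>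
    (\<forall>n. T (real n) = tetration n) \<and> strict_mono_on {0..} T \<and> T ` {0..} = {1..}"

text \<open>The super-logarithm belonging to the extension \<open>T\<close>, meaningful on \<open>{1..}\<close>.\<close>

definition slog :: "(real \<Rightarrow> real) \<Rightarrow> real \<Rightarrow> real"
  where "slog T = the_inv_into {0..} T"

end

theory Submission
  imports Defs
begin

text \<open>
  Since \<open>log\<^sup>[\<^sup>k\<^sup>] (\<^sup>n2) = \<^sup>n\<^sup>-\<^sup>k2\<close> for \<open>k \<le> n\<close>, we have \<open>log\<^sup>* (\<^sup>n2) = n\<close>, and the difference in question is a natural number
  \<open>j\<close> satisfying \<open>\<^sup>j2 \<ge> n - j\<close>. As \<open>\<^sup>j2 \<ge> 2 j\<close>, this gives \<open>3/2 \<cdot> \<^sup>j2 \<ge> n\<close>, that is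
  \<open>slog (2/3 \<cdot> n) \<le> j\<close>.
\<close>

lemma tetration_ge_Suc: "tetration n \<ge> real (Suc n)"
proof (induction n)
  case (Suc n)
  have "real (Suc (Suc n)) \<le> real (2 ^ Suc n)"
    using less_exp[of "Suc n"] by (simp only: of_nat_le_iff Suc_le_eq)
  also have "\<dots> = 2 powr real (Suc n)"
    by (simp add: powr_realpow flip: of_nat_Suc)
  also have "\<dots> \<le> tetration (Suc n)"
    using Suc.IH by simp
  finally show ?case .
qed simp

text \<open>Exponentiating the linear bound at \<open>m\<close> gives \<open>2 ^ Suc m\<close>,
  twice a power that exceeds \<open>m\<close>. Equality at 1 and 2 makes the factor 2
  optimal.\<close>

lemma tetration_ge_double: "tetration n \<ge> 2 * real n"
proof (cases n)
  case (Suc m)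
  have "2 * real (Suc m) \<le> 2 * real (2 ^ m)"
    using less_exp[of m] by (simp only: of_nat_le_iff Suc_le_eq mult_le_cancel_left_pos zero_less_numeral)
  also have "\<dots> = 2 powr real (Suc m)"
    by (simp add: powr_realpow flip: of_nat_Suc)
  also have "\<dots> \<le> tetration (Suc m)"
    using tetration_ge_Suc[of m] by simp
  finally show ?thesis using Suc by simp
qed simp

lemma lg_tetration_Suc [simp]: "lg (tetration (Suc n)) = tetration n"
  using tetration_ge_Suc[of "Suc n"] by (simp add: lg_def max_def)

lemma funpow_lg_tetration: "k \<le> n \<Longrightarrow> (lg ^^ k) (tetration n) = tetration (n - k)"
proof (induction k)
  case (Suc k)
  then have "n - k = Suc (n - Suc k)" by simp
  with Suc show ?case by (simp del: tetration.simps)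
qed simp

text \<open>The iterate of index \<open>n\<close> is 1, the next is 0, and the truncation in
  \<open>lg\<close> makes 0 a fixed point. This bounds the candidates for
  \<open>log_circledast\<close>.\<close>

lemma funpow_lg_tetration_eq_0:
  assumes "k > n"
  shows "(lg ^^ k) (tetration n) = 0"
proof -
  have "(lg ^^ (Suc n + m)) (tetration n) = 0" for m
  proof (induction m)
    case 0
    show ?case using funpow_lg_tetration[of n n] by (simp add: lg_def[of 1])
  qed (simp add: lg_def[of 0])
  moreover obtain m where "k = Suc n + m"
    using assms by (metis Suc_leI le_Suc_ex)
  ultimately show ?thesis by blast
qed

lemma log_star_tetration [simp]: "log_star (tetration n) = n"
  unfolding log_star_def
proof (rule Least_equality)
  show "(lg ^^ n) (tetration n) \<le> 1"
    by (simp add: funpow_lg_tetration)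
next
  fix k
  assume *: "(lg ^^ k) (tetration n) \<le> 1"
  show "n \<le> k"
  proof (rule ccontr)
    assume "\<not> n \<le> k"
    \<comment> \<open>Here \<open>n - k\<close> is positive, so the iterate is at least 2.\<close>
    then show False
      using * tetration_ge_Suc[of "n - k"] by (simp add: funpow_lg_tetration)
  qed
qed

lemma log_circledast_tetration:
  defines "k \<equiv> \<lambda>n. log_circledast (tetration n)"
  shows "k n \<le> n" and "tetration (n - k n) \<ge> real (k n)"
proof -
  let ?P = "\<lambda>i. (lg ^^ i) (tetration n) \<ge> real i"
  have bound: "i \<le> n" if "?P i" for i
    using that funpow_lg_tetration_eq_0[of n i] by (cases "i \<le> n") auto
  \<comment> \<open>A witness and the upper bound \<open>n\<close> together ensure that the greatest
    index exists and satisfies \<open>?P\<close>.\<close>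
  have "?P 0"
    using tetration_ge_Suc[of n] by simp
  then have "?P (GREATEST i. ?P i)"
    by (rule GreatestI_nat) (use bound in blast)
  moreover have "k n = (GREATEST i. ?P i)"
    using tetration_ge_Suc[of n] by (simp add: k_def log_circledast_def)
  ultimately have "?P (k n)" by simp
  then show "k n \<le> n" by (rule bound)
  with \<open>?P (k n)\<close> show "tetration (n - k n) \<ge> real (k n)"
    by (simp add: funpow_lg_tetration)
qed

text \<open>Surjectivity gives a preimage of \<open>x\<close>; strict monotonicity makes it unique
  and compares it with \<open>j\<close>.\<close>

lemma slog_le_of_nat:
  assumes "tetration_extension T" and "1 \<le> x" and "x \<le> tetration j"
  shows "slog T x \<le> real j"
proof -
  have mono: "strict_mono_on {0..} T" and range: "T ` {0..} = {1..}" and "T (real j) = tetration j"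
    using assms(1) by (auto simp: tetration_extension_def)
  obtain s where s: "s \<ge> 0" "T s = x"
    using range assms(2) by (metis atLeast_iff imageE)
  have "slog T x = s"
    unfolding slog_def using s strict_mono_on_imp_inj_on[OF mono]
    by (auto intro: the_inv_into_f_eq)
  moreover have "s \<le> real j"
    using strict_mono_on_less_eq[OF mono, of s "real j"] s assms(3) \<open>T (real j) = tetration j\<close>
    by simp
  ultimately show ?thesis by simp
qed

theorem theorem4p20:
  fixes T :: "real \<Rightarrow> real" and n :: nat
  assumes "tetration_extension T"
    and "n \<ge> 2"
  shows "real (log_star (tetration n)) - real (log_circledast (tetration n)) \<ge> slog T (2 / 3 * real n)"
proof -
  define k where "k = log_circledast (tetration n)"
  have "k \<le> n" and "tetration (n - k) \<ge> real k"
    unfolding k_def by (rule log_circledast_tetration)+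
  \<comment> \<open>Split \<open>n\<close> as \<open>k + (n - k)\<close>: the first part is at most
    the tetration value, the second at most half of it.\<close>
  then have "2 / 3 * real n \<le> tetration (n - k)"
    using tetration_ge_double[of "n - k"] by (simp add: of_nat_diff)
  \<comment> \<open>The argument must lie in the domain of the super-logarithm.\<close>
  moreover have "1 \<le> 2 / 3 * real n"
    using assms(2) by simp
  ultimately have "slog T (2 / 3 * real n) \<le> real (n - k)"
    by (intro slog_le_of_nat assms(1))
  with \<open>k \<le> n\<close> show ?thesis
    by (simp add: k_def of_nat_diff)
qed

end
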